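(* Let $(E_0,E_1)$ and $(F_0,F_1)$ be Banach couples, let $\rho\in\mathcal{B}^{+-}$ and $\gamma(t)=1/\overline{\rho}(t^{-1})$ for $t>0$. Let $E$ be a Banach space of class $K_\gamma(E_0,E_1)$, let $F$ be a Banach space of class $K_\rho(F_0,F_1)$, and let $G$ be any Banach space. Let $T\in Bil((E_0+E_1)\times(F_0+F_1),G)$ be such that $T$ is compact from $E_0\times F_0$ into $G$. Then $T$ is compact from $E\times F$ into $G$.
   Context: A Banach couple $(X_0,X_1)$ is a pair of Banach spaces continuously embedded in a common Hausdorff topological vector space. $X_0\cap X_1$ has norm $\max\{\|x\|_{X_0},\|x\|_{X_1}\}$ and $X_0+X_1$ has norm $\inf_{x=x_0+x_1}(\|x_0\|_{X_0}+\|x_1\|_{X_1})$. A Banach space $X$ is intermediate with respect to $(X_0,X_1)$ if $X_0\cap X_1\hookrightarrow X\hookrightarrow X_0+X_1$ with bounded embeddings. For Banach spaces $X,Y,Z$, $Bil(X\times Y,Z)$ is the space of bounded bilinear operators from $X\times Y$ into $Z$. Such an operator is compact if the image of $\{(x,y):\max\{\|x\|_X,\|y\|_Y\}\le1\}$ is totally bounded in $Z$. A function parameter is a continuous positive function $\rho$ on $(0,\infty)$. It belongs to $\mathcal{B}$ if $\rho(1)=1$ and $\overline{\rho}(s)=\sup_{t>0}\rho(st)/\rho(t)<\infty$ for all $s>0$. It belongs to $\mathcal{B}^{+-}$ if moreover $\int_0^\infty\min(1,1/t)\,\overline{\rho}(t)\,\frac{dt}{t}<\infty$. For $x\in X_0+X_1$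 let $K(t,x)=\inf_{x=x_0+x_1}(\|x_0\|_{X_0}+t\|x_1\|_{X_1})$. For $f=\rho$ or $f=\gamma$, $(X_0,X_1)_{f,\infty;K}$ is the space of $x\in X_0+X_1$ with $\|x\|_{f,\infty;K}=\sup_{n\in\mathbb{Z}}f(2^n)^{-1}K(2^n,x)<\infty$. An intermediate space $X$ is of class $K_f(X_0,X_1)$ if $X\hookrightarrow(X_0,X_1)_{f,\infty;K}$ (bounded embedding). *)

theory Defs
  imports "HOL-Analysis.Analysis"
begin

text \<open>
  Real scalars throughout. Complex Banach couples are covered by restriction of scalars: the norms,
  the K-functional and total boundedness do not depend on the scalar field.
\<close>

class hausdorff_tvs = real_vector + topological_ab_group_add + t2_space +
  assumes tendsto_scaleR_Pair:
    "LIM p (nhds c \<times>\<^sub>F nhds x). fst p *\<^sub>R snd p :> nhds (c *\<^sub>R x)"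

text \<open>
  A normed space living inside an ambient vector space. Only the values of \<open>vnorm\<close> on \<open>vecs\<close>
  are meaningful.
\<close>

record 'a nspace =
  vecs :: "'a set"
  vnorm :: "'a \<Rightarrow> real"

definition normed_space :: "'a::real_vector nspace \<Rightarrow> bool" where
  "normed_space X \<longleftrightarrow>
     subspace (vecs X) \<and>
     (\<forall>x\<in>vecs X. 0 \<le> vnorm X x) \<and>
     (\<forall>x\<in>vecs X. vnorm X x = 0 \<longleftrightarrow> x = 0) \<and>
     (\<forall>c. \<forall>x\<in>vecs X. vnorm X (c *\<^sub>R x) = \<bar>c\<bar> * vnorm X x) \<and>
     (\<forall>x\<in>vecs X. \<forall>y\<in>vecs X. vnorm X (x + y) \<le> vnorm X x + vnorm X y)"

text \<open>
  The locale \<^locale>\<open>Metric_space\<close> demands nonnegativity and symmetry of the metric on the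
  whole type, hence the value 0 outside \<open>vecs X\<close>.
\<close>

definition ndist :: "'a::real_vector nspace \<Rightarrow> 'a \<Rightarrow> 'a \<Rightarrow> real" where
  "ndist X x y = (if x \<in> vecs X \<and> y \<in> vecs X then vnorm X (x - y) else 0)"

lemma Metric_space_ndist:
  assumes "normed_space X"
  shows "Metric_space (vecs X) (ndist X)"
proof (rule Metric_space.intro)
  have sub: "subspace (vecs X)"
    and pos: "\<And>x. x \<in> vecs X \<Longrightarrow> 0 \<le> vnorm X x"
    and zero: "\<And>x. x \<in> vecs X \<Longrightarrow> vnorm X x = 0 \<longleftrightarrow> x = 0"
    and scale: "\<And>c x. x \<in> vecs X \<Longrightarrow> vnorm X (c *\<^sub>R x) = \<bar>c\<bar> * vnorm X x"
    and tri: "\<And>x y. x \<in> vecs X \<Longrightarrow> y \<in> vecs X \<Longrightarrow> vnorm X (x + y) \<le> vnorm X x + vnorm X y"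
    using assms by (simp_all add: normed_space_def)
  note diff = subspace_diff[OF sub]
  show "0 \<le> ndist X x y" for x y
    by (simp add: ndist_def pos diff)
  show "ndist X x y = ndist X y x" for x y
    using scale[of "y - x" "-1"] diff[of y x] by (simp add: ndist_def)
  show "ndist X x y = 0 \<longleftrightarrow> x = y" if "x \<in> vecs X" "y \<in> vecs X" for x y
    using that zero[OF diff[OF that]] by (simp add: ndist_def)
  show "ndist X x z \<le> ndist X x y + ndist X y z"
    if "x \<in> vecs X" "y \<in> vecs X" "z \<in> vecs X" for x y z
    using that tri[OF diff[of x y] diff[of y z]] by (simp add: ndist_def)
qed

abbreviation ntopology :: "'a::real_vector nspace \<Rightarrow> 'a topology" where
  "ntopology X \<equiv> Metric_space.mtopology (vecs X) (ndist X)"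

definition banach_space :: "'a::real_vector nspace \<Rightarrow> bool" where
  "banach_space X \<longleftrightarrow> normed_space X \<and> Metric_space.mcomplete (vecs X) (ndist X)"

definition banach_couple :: "'a::hausdorff_tvs nspace \<Rightarrow> 'a nspace \<Rightarrow> bool" where
  "banach_couple X0 X1 \<longleftrightarrow>
     banach_space X0 \<and> banach_space X1 \<and>
     continuous_map (ntopology X0) euclidean (\<lambda>x. x) \<and>
     continuous_map (ntopology X1) euclidean (\<lambda>x. x)"

definition inter_space :: "'a nspace \<Rightarrow> 'a nspace \<Rightarrow> 'a nspace" where
  "inter_space X0 X1 =
     \<lparr>vecs = vecs X0 \<inter> vecs X1, vnorm = (\<lambda>x. max (vnorm X0 x) (vnorm X1 x))\<rparr>"

definition sum_space :: "'a::real_vector nspace \<Rightarrow> 'a nspace \<Rightarrow> 'a nspace" where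
  "sum_space X0 X1 =
     \<lparr>vecs = {x0 + x1 | x0 x1. x0 \<in> vecs X0 \<and> x1 \<in> vecs X1},
      vnorm = (\<lambda>x. Inf {vnorm X0 x0 + vnorm X1 x1 | x0 x1.
                          x0 \<in> vecs X0 \<and> x1 \<in> vecs X1 \<and> x = x0 + x1})\<rparr>"

definition K_functional ::
  "'a::real_vector nspace \<Rightarrow> 'a nspace \<Rightarrow> real \<Rightarrow> 'a \<Rightarrow> real" where
  "K_functional X0 X1 t x =
     Inf {vnorm X0 x0 + t * vnorm X1 x1 | x0 x1.
            x0 \<in> vecs X0 \<and> x1 \<in> vecs X1 \<and> x = x0 + x1}"

definition embedded :: "'a nspace \<Rightarrow> 'a nspace \<Rightarrow> bool" (infix \<open>\<hookrightarrow>\<close> 50) where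
  "X \<hookrightarrow> Y \<longleftrightarrow>
     vecs X \<subseteq> vecs Y \<and> (\<exists>C. \<forall>x\<in>vecs X. vnorm Y x \<le> C * vnorm X x)"

definition intermediate_space ::
  "'a::real_vector nspace \<Rightarrow> 'a nspace \<Rightarrow> 'a nspace \<Rightarrow> bool" where
  "intermediate_space X0 X1 X \<longleftrightarrow>
     banach_space X \<and> inter_space X0 X1 \<hookrightarrow> X \<and> X \<hookrightarrow> sum_space X0 X1"

text \<open>
  Suprema of reals are only meaningful for bounded families, so finiteness of a supremum is
  expressed by \<^const>\<open>bdd_above\<close>, both here and in \<open>class_B\<close>.
\<close>

definition K_space ::
  "(real \<Rightarrow> real) \<Rightarrow> 'a::real_vector nspace \<Rightarrow> 'a nspace \<Rightarrow> 'a nspace" where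
  "K_space f X0 X1 =
     \<lparr>vecs = {x \<in> vecs (sum_space X0 X1).
                bdd_above (range (\<lambda>n::int. inverse (f (2 powi n)) * K_functional X0 X1 (2 powi n) x))},
      vnorm = (\<lambda>x. SUP n::int. inverse (f (2 powi n)) * K_functional X0 X1 (2 powi n) x)\<rparr>"

definition class_K ::
  "(real \<Rightarrow> real) \<Rightarrow> 'a::real_vector nspace \<Rightarrow> 'a nspace \<Rightarrow> 'a nspace \<Rightarrow> bool" where
  "class_K f X0 X1 X \<longleftrightarrow> intermediate_space X0 X1 X \<and> X \<hookrightarrow> K_space f X0 X1"

definition function_parameter :: "(real \<Rightarrow> real) \<Rightarrow> bool" where
  "function_parameter \<rho> \<longleftrightarrow> continuous_on {0<..} \<rho> \<and> (\<forall>t>0. 0 < \<rho> t)"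

definition dilation :: "(real \<Rightarrow> real) \<Rightarrow> real \<Rightarrow> real" where
  "dilation \<rho> s = (SUP t\<in>{0<..}. \<rho> (s * t) / \<rho> t)"

definition class_B :: "(real \<Rightarrow> real) \<Rightarrow> bool" where
  "class_B \<rho> \<longleftrightarrow>
     function_parameter \<rho> \<and> \<rho> 1 = 1 \<and>
     (\<forall>s>0. bdd_above ((\<lambda>t. \<rho> (s * t) / \<rho> t) ` {0<..}))"

definition class_B_pm :: "(real \<Rightarrow> real) \<Rightarrow> bool" where
  "class_B_pm \<rho> \<longleftrightarrow>
     class_B \<rho> \<and>
     (\<integral>\<^sup>+ t\<in>{0<..}. ennreal (min 1 (1 / t) * dilation \<rho> t / t) \<partial>lborel) < \<infinity>"

definition bounded_bilinear_op ::
  "'a::real_vector nspace \<Rightarrow> 'b::real_vector nspace \<Rightarrow> ('a \<Rightarrow> 'b \<Rightarrow> 'c::real_normed_vector) \<Rightarrow> bool" where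
  "bounded_bilinear_op X Y T \<longleftrightarrow>
     (\<forall>x\<in>vecs X. \<forall>x'\<in>vecs X. \<forall>y\<in>vecs Y. T (x + x') y = T x y + T x' y) \<and>
     (\<forall>x\<in>vecs X. \<forall>y\<in>vecs Y. \<forall>y'\<in>vecs Y. T x (y + y') = T x y + T x y') \<and>
     (\<forall>c. \<forall>x\<in>vecs X. \<forall>y\<in>vecs Y. T (c *\<^sub>R x) y = c *\<^sub>R T x y) \<and>
     (\<forall>c. \<forall>x\<in>vecs X. \<forall>y\<in>vecs Y. T x (c *\<^sub>R y) = c *\<^sub>R T x y) \<and>
     (\<exists>C. \<forall>x\<in>vecs X. \<forall>y\<in>vecs Y. norm (T x y) \<le> C * vnorm X x * vnorm Y y)"

definition compact_bilinear_op ::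
  "'a::real_vector nspace \<Rightarrow> 'b::real_vector nspace \<Rightarrow> ('a \<Rightarrow> 'b \<Rightarrow> 'c::real_normed_vector) \<Rightarrow> bool" where
  "compact_bilinear_op X Y T \<longleftrightarrow>
     bounded_bilinear_op X Y T \<and>
     totally_bounded {T x y | x y. x \<in> vecs X \<and> y \<in> vecs Y \<and> max (vnorm X x) (vnorm Y y) \<le> 1}"

end

theory Submission
  imports Defs
begin

text \<open>
  Because \<open>T\<close> is bounded on the sum spaces, it suffices to split each \<open>x\<close> in the unit ball of \<open>E\<close>
  as \<open>x = x\<^sub>0 + x\<^sub>1\<close> with \<open>x\<^sub>1\<close> arbitrarily small in \<open>E\<^sub>1\<close> and \<open>x\<^sub>0\<close> bounded in \<open>E\<^sub>0\<close>, and
  likewise \<open>y = y\<^sub>0 + y\<^sub>1\<close>: in \<open>T x y = T x\<^sub>0 y\<^sub>0 + T x y\<^sub>1 + T x\<^sub>1 (y - y\<^sub>1)\<close> the last two terms are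
  small and the first one stays in a multiple of a totally bounded set. The splittings are
  near-optimal ones for \<open>K(2\<^sup>n, \<cdot>)\<close>, and they exist as soon as \<open>\<gamma>(2\<^sup>n)/2\<^sup>n\<close> and \<open>\<rho>(2\<^sup>n)/2\<^sup>n\<close> take
  arbitrarily small values. As both are at most \<open>\<rho>'(2\<^sup>n)/2\<^sup>n\<close> with \<open>\<rho>'\<close> the dilation function, a
  positive lower bound for them would, by submultiplicativity and local boundedness of \<open>\<rho>'\<close>
  (a Baire category argument), give \<open>\<rho>'(t)/t \<ge> c > 0\<close> on \<open>[1,\<infinity>)\<close> and make the integral diverge.
\<close>

section \<open>The dilation function\<close>

lemma dilation_upper:
  assumes "class_B \<rho>" "s > 0" "t > 0"
  shows "\<rho> (s * t) \<le> dilation \<rho> s * \<rho> t"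
proof -
  have "\<rho> (s * t) / \<rho> t \<le> dilation \<rho> s"
    unfolding dilation_def using assms by (intro cSUP_upper) (auto simp: class_B_def)
  moreover have "\<rho> t > 0"
    using assms by (auto simp: class_B_def function_parameter_def)
  ultimately show ?thesis by (simp add: field_simps)
qed

text \<open>Membership in \<open>class_B\<close> makes the supremum a genuine one and \<rho> is
  positive, so upper bounds on the dilation function can be checked pointwise and without
  division.\<close>

lemma dilation_le_iff:
  assumes "class_B \<rho>" "s > 0"
  shows "dilation \<rho> s \<le> M \<longleftrightarrow> (\<forall>t>0. \<rho> (s * t) \<le> M * \<rho> t)"
proof -
  have pos: "\<rho> t > 0" if "t > 0" for t
    using assms that by (auto simp: class_B_def function_parameter_def)
  have "dilation \<rho> s \<le> M \<longleftrightarrow> (\<forall>t\<in>{0<..}. \<rho> (s * t) / \<rho> t \<le> M)"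
    unfolding dilation_def
    using assms by (intro cSUP_le_iff) (auto simp: class_B_def)
  also have "\<dots> \<longleftrightarrow> (\<forall>t>0. \<rho> (s * t) \<le> M * \<rho> t)"
    using pos by (auto simp: divide_le_eq)
  finally show ?thesis .
qed

text \<open>This is the quotient in the supremum at \<open>t = 1\<close>, where \<rho> is normalised
  to 1. Smallness of the dilation function thereby passes to \<rho>.\<close>

lemma le_dilation:
  assumes "class_B \<rho>" "s > 0"
  shows "\<rho> s \<le> dilation \<rho> s"
  using dilation_upper[OF assms, of 1] assms by (simp add: class_B_def)

lemma dilation_pos:
  assumes "class_B \<rho>" "s > 0"
  shows "dilation \<rho> s > 0"
  using le_dilation[OF assms] assms by (force simp: class_B_def function_parameter_def)

lemma dilation_nonneg: "class_B \<rho> \<Longrightarrow> s > 0 \<Longrightarrow> 0 \<le> dilation \<rho> s"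
  by (rule less_imp_le) (rule dilation_pos)

text \<open>Dilating by \<open>s * t\<close> is dilating by \<open>t\<close> and then by
  \<open>s\<close>, each at the cost of its own factor.\<close>

lemma dilation_mult_le:
  assumes "class_B \<rho>" "s > 0" "t > 0"
  shows "dilation \<rho> (s * t) \<le> dilation \<rho> s * dilation \<rho> t"
proof -
  have "\<rho> (s * t * u) \<le> dilation \<rho> s * dilation \<rho> t * \<rho> u" if "u > 0" for u
  proof -
    have "\<rho> (s * (t * u)) \<le> dilation \<rho> s * \<rho> (t * u)"
      using assms that by (intro dilation_upper) auto
    also have "\<dots> \<le> dilation \<rho> s * (dilation \<rho> t * \<rho> u)"
      using assms that by (intro mult_left_mono dilation_upper dilation_nonneg) auto
    finally show ?thesis by (simp add: mult.assoc)
  qed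
  then show ?thesis using assms by (simp add: dilation_le_iff)
qed

lemma dilation_power_le:
  assumes "class_B \<rho>" "s > 0"
  shows "dilation \<rho> (s ^ k) \<le> dilation \<rho> s ^ k"
proof (induction k)
  case 0
  then show ?case using assms by (simp add: dilation_le_iff)
next
  case (Suc k)
  have "dilation \<rho> (s * s ^ k) \<le> dilation \<rho> s * dilation \<rho> (s ^ k)"
    using assms by (intro dilation_mult_le) auto
  also have "\<dots> \<le> dilation \<rho> s * dilation \<rho> s ^ k"
    using Suc assms by (intro mult_left_mono) (auto intro: dilation_nonneg)
  finally show ?case by simp
qed

text \<open>Submultiplicativity at the product 1. After division by the second factor it bounds
  \<open>1 / dilation \<rho> (1 / s)\<close>, which is \<gamma> at \<open>s\<close>, by
  \<open>dilation \<rho> s\<close>.\<close>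

lemma one_le_dilation_mult_inverse:
  assumes "class_B \<rho>" "s > 0"
  shows "1 \<le> dilation \<rho> s * dilation \<rho> (1 / s)"
proof -
  have "1 \<le> dilation \<rho> (s * (1 / s))"
    using le_dilation[OF assms(1), of 1] assms by (simp add: class_B_def)
  also have "\<dots> \<le> dilation \<rho> s * dilation \<rho> (1 / s)"
    using assms by (intro dilation_mult_le) auto
  finally show ?thesis .
qed

text \<open>The dilation function is finite and, as a supremum of continuous functions, lower
  semicontinuous. Its sublevel sets are therefore closed, and those at integer levels cover the
  line, so by Baire one of them contains an interval.\<close>

lemma dilation_bounded_on_interval:
  assumes "class_B \<rho>"
  obtains a b M where "a < b" "\<And>x. x \<in> {a..b} \<Longrightarrow> dilation \<rho> (exp x) \<le> M"
proof -
  \<comment> \<open>In the variable \<open>x = ln s\<close> the domain is the whole real line, and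
    multiplication of arguments becomes translation.\<close>
  define D where "D M = {x. dilation \<rho> (exp x) \<le> M}" for M
  have closed_D: "closed (D M)" for M
  proof -
    have "D M = (\<Inter>t\<in>{0<..}. {x. \<rho> (exp x * t) \<le> M * \<rho> t})"
      using assms by (auto simp: D_def dilation_le_iff)
    moreover have "closed {x. \<rho> (exp x * t) \<le> M * \<rho> t}" if "t > 0" for t
    proof -
      have "continuous_on UNIV (\<lambda>x. \<rho> (exp x * t))"
      proof (rule continuous_on_compose2[of "{0<..}" \<rho> UNIV "\<lambda>x. exp x * t"])
        show "continuous_on {0<..} \<rho>"
          using assms by (simp add: class_B_def function_parameter_def)
        show "continuous_on UNIV (\<lambda>x. exp x * t)" by (intro continuous_intros)
      qed (use that in auto)
      then show ?thesis by (rule closed_Collect_le) (rule continuous_on_const)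
    qed
    ultimately show ?thesis by auto
  qed
  have "\<exists>n::nat. interior (D (real n)) \<noteq> {}"
  proof (rule ccontr)
    assume "\<nexists>n::nat. interior (D (real n)) \<noteq> {}"
    then have "euclidean interior_of \<Union>(range (\<lambda>n::nat. D (real n))) = ({} :: real set)"
      using closed_D
      by (intro Baire_category_alt) (auto simp: completely_metrizable_space_euclidean)
    moreover have "\<Union>(range (\<lambda>n::nat. D (real n))) = UNIV"
      by (auto simp: D_def real_arch_simple)
    ultimately show False by simp
  qed
  then obtain n :: nat and x where "x \<in> interior (D (real n))" by blast
  then obtain e where e: "e > 0" "cball x e \<subseteq> D (real n)"
    by (meson mem_interior_cball)
  show thesis
  proof (rule that[of "x - e" "x + e" "real n"])
    show "dilation \<rho> (exp y) \<le> real n" if "y \<in> {x - e..x + e}" for y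
      using e that by (auto simp: D_def cball_eq_atLeastAtMost)
  qed (use e in auto)
qed

text \<open>Submultiplicativity spreads the bound on one interval: a translation in the logarithmic
  variable brings the interval to the origin, and \<open>k\<close>-th roots bring all of
  \<open>[1,2]\<close> into it.\<close>

lemma dilation_bounded_on_1_2:
  assumes "class_B \<rho>"
  obtains M where "M > 0" "\<And>s. 1 \<le> s \<Longrightarrow> s \<le> 2 \<Longrightarrow> dilation \<rho> s \<le> M"
proof -
  obtain a b M where ab: "a < b" and M: "\<And>x. x \<in> {a..b} \<Longrightarrow> dilation \<rho> (exp x) \<le> M"
    using dilation_bounded_on_interval[OF assms] by blast
  \<comment> \<open>Writing \<open>exp x\<close> as \<open>exp (a + x) * exp (- a)\<close> carries
    the bound from \<open>[a, b]\<close> to \<open>[0, b - a]\<close> at the price of the second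
    factor.\<close>
  define N where "N = M * dilation \<rho> (exp (- a))"
  have N: "dilation \<rho> (exp x) \<le> N" if "0 \<le> x" "x \<le> b - a" for x
  proof -
    have "dilation \<rho> (exp (a + x) * exp (- a)) \<le> dilation \<rho> (exp (a + x)) * dilation \<rho> (exp (- a))"
      using assms by (intro dilation_mult_le) auto
    also have "\<dots> \<le> N"
      unfolding N_def using assms that
      by (intro mult_right_mono M) (auto intro: dilation_nonneg)
    finally show ?thesis by (simp flip: exp_add)
  qed
  \<comment> \<open>With this \<open>k\<close>, \<open>ln s / k\<close> lies in
    \<open>[0, b - a]\<close> for every \<open>s\<close> in \<open>[1,2]\<close>.\<close>
  obtain k :: nat where k: "ln 2 / (b - a) < real k"
    using reals_Archimedean2 by blast
  have "ln 2 / (b - a) > 0" using ab by simp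
  then have "k > 0" using k by (cases k) auto
  have "0 < N"
    using N[of 0] ab dilation_pos[OF assms, of "exp 0"] by simp
  show thesis
  proof (rule that[of "N ^ k"])
    show "N ^ k > 0" using \<open>0 < N\<close> by simp
    fix s :: real assume s: "1 \<le> s" "s \<le> 2"
    have "ln s \<le> ln 2" using s by simp
    also have "\<dots> \<le> real k * (b - a)"
      using k ab by (simp add: divide_less_eq)
    finally have "ln s / k \<le> b - a"
      using \<open>k > 0\<close> by (simp add: field_simps)
    then have "dilation \<rho> (exp (ln s / k)) \<le> N"
      using s by (intro N) auto
    then have "dilation \<rho> (exp (ln s / k)) ^ k \<le> N ^ k"
      using assms by (intro power_mono) (auto intro: dilation_nonneg)
    moreover have "dilation \<rho> (exp (ln s / k) ^ k) \<le> dilation \<rho> (exp (ln s / k)) ^ k"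
      using assms by (intro dilation_power_le) auto
    moreover have "exp (ln s / k) ^ k = s"
      using s \<open>k > 0\<close> by (simp flip: exp_of_nat_mult)
    ultimately show "dilation \<rho> s \<le> N ^ k" by simp
  qed
qed

text \<open>Powers of 2 are the points at which \<open>K_space\<close> samples the
  K-functional.\<close>

lemma class_B_pm_dilation_small:
  assumes "class_B_pm \<rho>" "\<epsilon> > 0"
  obtains n :: nat where "dilation \<rho> (2 ^ n) < \<epsilon> * 2 ^ n"
proof (rule ccontr)
  assume "\<not> thesis"
  then have ge: "\<epsilon> * 2 ^ n \<le> dilation \<rho> (2 ^ n)" for n :: nat
    using that by (meson not_le)
  have B: "class_B \<rho>" using assms by (simp add: class_B_pm_def)
  obtain M where M: "M > 0" "\<And>s. 1 \<le> s \<Longrightarrow> s \<le> 2 \<Longrightarrow> dilation \<rho> s \<le> M"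
    using dilation_bounded_on_1_2[OF B] by blast
  define c where "c = \<epsilon> / M"
  have "c > 0" using assms M by (simp add: c_def)
  have lower: "c * u \<le> dilation \<rho> u" if "u \<ge> 1" for u
  proof -
    \<comment> \<open>Rounding the logarithm up puts \<open>2 ^ n / u\<close> into
      \<open>[1,2]\<close>, where \<open>M\<close> bounds the dilation function. Passing from
      \<open>2 ^ n\<close> to \<open>u\<close> thus costs the factor \<open>M\<close> in
      \<open>c\<close>.\<close>
    define n where "n = nat \<lceil>log 2 u\<rceil>"
    have "log 2 u \<ge> 0" using that by simp
    then have n: "log 2 u \<le> n" "n \<le> log 2 u + 1" unfolding n_def by linarith+
    have "u \<le> 2 ^ n"
      using n(1) that by (simp add: log_le_iff powr_realpow)
    have "2 powr n \<le> 2 powr (log 2 u + 1)" using n(2) by simp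
    then have "2 ^ n \<le> 2 * u"
      using that by (simp add: powr_realpow powr_add)
    have "\<epsilon> * u \<le> \<epsilon> * 2 ^ n" using \<open>u \<le> 2 ^ n\<close> assms by simp
    also have "\<dots> \<le> dilation \<rho> (2 ^ n)" by (rule ge)
    also have "\<dots> = dilation \<rho> (u * (2 ^ n / u))" using that by simp
    also have "\<dots> \<le> dilation \<rho> u * dilation \<rho> (2 ^ n / u)"
      using that B by (intro dilation_mult_le) auto
    also have "\<dots> \<le> dilation \<rho> u * M"
      using that \<open>u \<le> 2 ^ n\<close> \<open>2 ^ n \<le> 2 * u\<close> B
      by (intro mult_left_mono M) (auto simp: field_simps intro: dilation_nonneg)
    finally show ?thesis using M by (simp add: c_def field_simps)
  qed
  define I where "I = (\<integral>\<^sup>+ t\<in>{0<..}. ennreal (min 1 (1 / t) * dilation \<rho> t / t) \<partial>lborel)"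
  have "I < \<infinity>" using assms by (simp add: class_B_pm_def I_def)
  then obtain r where r: "I = ennreal r" "r \<ge> 0"
    by (cases I) auto
  \<comment> \<open>Chosen so that \<open>c * ln b = r + 1\<close> exceeds the value
    \<open>r\<close> of the integral.\<close>
  define b where "b = exp ((r + 1) / c)"
  have "b \<ge> 1" using \<open>c > 0\<close> r by (simp add: b_def)
  have "(\<integral>\<^sup>+ t. ennreal (c / t) * indicator {1..b} t \<partial>lborel) = ennreal (c * ln b - c * ln 1)"
    using \<open>b \<ge> 1\<close> \<open>c > 0\<close>
    by (intro nn_integral_FTC_Icc) (auto intro!: derivative_eq_intros)
  then have "ennreal (r + 1) = (\<integral>\<^sup>+ t. ennreal (c / t) * indicator {1..b} t \<partial>lborel)"
    using \<open>c > 0\<close> by (simp add: b_def)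
  also have "\<dots> \<le> I"
    unfolding I_def
  proof (intro nn_integral_mono)
    fix t :: real
    show "ennreal (c / t) * indicator {1..b} t
        \<le> ennreal (min 1 (1 / t) * dilation \<rho> t / t) * indicator {0<..} t"
    proof (cases "1 \<le> t \<and> t \<le> b")
      case True
      \<comment> \<open>For \<open>t \<ge> 1\<close> the integrand equals
        \<open>dilation \<rho> t / (t * t)\<close>, which \<open>lower\<close> bounds below by
        \<open>c / t\<close>.\<close>
      then have "min 1 (1 / t) = 1 / t" by (simp add: min_def)
      then have "c / t \<le> min 1 (1 / t) * dilation \<rho> t / t"
        using lower[of t] True by (simp add: field_simps)
      then show ?thesis using True by (auto intro: ennreal_leI)
    qed auto
  qed
  finally show False using r by simp
qed

section \<open>Splitting elements of spaces of class K\<close>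

lemma sum_space_norm_le:
  assumes "normed_space X0" "normed_space X1" "x0 \<in> vecs X0" "x1 \<in> vecs X1"
  shows "vnorm (sum_space X0 X1) (x0 + x1) \<le> vnorm X0 x0 + vnorm X1 x1"
  unfolding sum_space_def nspace.simps
proof (rule cInf_lower)
  show "bdd_below {vnorm X0 u + vnorm X1 v |u v.
      u \<in> vecs X0 \<and> v \<in> vecs X1 \<and> x0 + x1 = u + v}"
    using assms by (intro bdd_belowI[of _ 0]) (auto simp: normed_space_def)
qed (use assms in blast)

lemma sum_space_right:
  assumes "normed_space X0" "normed_space X1" "x \<in> vecs X1"
  shows "x \<in> vecs (sum_space X0 X1)" "vnorm (sum_space X0 X1) x \<le> vnorm X1 x"
proof -
  have 0: "0 \<in> vecs X0" "vnorm X0 0 = 0"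
    using assms by (auto simp: normed_space_def subspace_0)
  have "x = 0 + x" by simp
  then show "x \<in> vecs (sum_space X0 X1)"
    unfolding sum_space_def using 0 assms by force
  show "vnorm (sum_space X0 X1) x \<le> vnorm X1 x"
    using sum_space_norm_le[OF assms(1,2) 0(1) assms(3)] 0 by simp
qed

lemma sum_space_left:
  assumes "normed_space X1" "x \<in> vecs X0"
  shows "x \<in> vecs (sum_space X0 X1)"
proof -
  have "0 \<in> vecs X1" using assms by (auto simp: normed_space_def subspace_0)
  moreover have "x = x + 0" by simp
  ultimately show ?thesis unfolding sum_space_def using assms by force
qed

text \<open>On the unit ball of \<open>X\<close>, the K-functional at \<open>2 ^ n\<close> is at
  most a constant times \<open>f (2 ^ n)\<close>, hence below \<open>\<epsilon> * 2 ^ n\<close> for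
  a suitable \<open>n\<close> independent of \<open>x\<close>. A near-optimal decomposition at that
  \<open>n\<close> yields both bounds, with \<open>R = \<epsilon> * 2 ^ n\<close>.\<close>

lemma class_K_split:
  assumes X0: "normed_space X0" and X1: "normed_space X1"
    and K: "class_K f X0 X1 X"
    and f_pos: "\<And>n::nat. f (2 ^ n) > 0"
    and f_small: "\<And>\<epsilon>. \<epsilon> > 0 \<Longrightarrow> \<exists>n::nat. f (2 ^ n) < \<epsilon> * 2 ^ n"
    and "\<epsilon> > 0"
  obtains R where "R > 0"
    "\<And>x. x \<in> vecs X \<Longrightarrow> vnorm X x \<le> 1 \<Longrightarrow>
      \<exists>x0\<in>vecs X0. \<exists>x1\<in>vecs X1. x = x0 + x1 \<and> vnorm X0 x0 \<le> R \<and> vnorm X1 x1 \<le> \<epsilon>"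
proof -
  obtain C where sub: "vecs X \<subseteq> vecs (K_space f X0 X1)"
    and C: "\<And>x. x \<in> vecs X \<Longrightarrow> vnorm (K_space f X0 X1) x \<le> C * vnorm X x"
    using K unfolding class_K_def embedded_def by blast
  \<comment> \<open>The embedding constant \<open>C\<close> may be zero or negative;
    \<open>C'\<close> can be divided by.\<close>
  define C' where "C' = max C 1"
  have C': "C \<le> C'" "C' > 0" by (auto simp: C'_def)
  obtain n :: nat where n: "f (2 ^ n) < \<epsilon> / C' * 2 ^ n"
    using f_small[of "\<epsilon> / C'"] C' \<open>\<epsilon> > 0\<close> by auto
  have X_pos: "vnorm X x \<ge> 0" if "x \<in> vecs X" for x
    using K that by (auto simp: class_K_def intermediate_space_def banach_space_def normed_space_def)
  show thesis
  proof (rule that[of "\<epsilon> * 2 ^ n"])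
    show "\<epsilon> * 2 ^ n > 0" using \<open>\<epsilon> > 0\<close> by simp
    fix x assume x: "x \<in> vecs X" "vnorm X x \<le> 1"
    let ?g = "\<lambda>n::int. inverse (f (2 powi n)) * K_functional X0 X1 (2 powi n) x"
    have "x \<in> vecs (K_space f X0 X1)" using x sub by auto
    then have bdd: "bdd_above (range ?g)" and "x \<in> vecs (sum_space X0 X1)"
      by (auto simp: K_space_def)
    have "?g (int n) \<le> (SUP n. ?g n)"
      using bdd by (intro cSUP_upper) auto
    also have "\<dots> = vnorm (K_space f X0 X1) x"
      by (simp add: K_space_def)
    also have "\<dots> \<le> C * vnorm X x" by (rule C[OF x(1)])
    also have "\<dots> \<le> C' * 1"
      using C' x X_pos by (intro mult_mono) auto
    finally have "K_functional X0 X1 (2 ^ n) x \<le> C' * f (2 ^ n)"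
      using f_pos[of n] by (simp add: field_simps)
    \<comment> \<open>Strictness matters: the infimum need not be attained, but some decomposition
      lies below any larger number.\<close>
    also have "\<dots> < \<epsilon> * 2 ^ n"
      using n C' by (simp add: field_simps)
    finally have less: "K_functional X0 X1 (2 ^ n) x < \<epsilon> * 2 ^ n" .
    let ?S = "{vnorm X0 x0 + 2 ^ n * vnorm X1 x1 | x0 x1.
            x0 \<in> vecs X0 \<and> x1 \<in> vecs X1 \<and> x = x0 + x1}"
    have "?S \<noteq> {}"
      using \<open>x \<in> vecs (sum_space X0 X1)\<close> by (auto simp: sum_space_def)
    then obtain s where "s \<in> ?S" "s < \<epsilon> * 2 ^ n"
      using less cInf_lessD[of ?S] unfolding K_functional_def by blast
    then obtain x0 x1 where x01: "x0 \<in> vecs X0" "x1 \<in> vecs X1" "x = x0 + x1"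
      and s: "vnorm X0 x0 + 2 ^ n * vnorm X1 x1 < \<epsilon> * 2 ^ n"
      by blast
    have nn: "vnorm X0 x0 \<ge> 0" "vnorm X1 x1 \<ge> 0"
      using x01 X0 X1 by (auto simp: normed_space_def)
    have "vnorm X0 x0 \<le> \<epsilon> * 2 ^ n" using s nn
      by (smt (verit) mult_nonneg_nonneg zero_le_power)
    moreover have "2 ^ n * vnorm X1 x1 \<le> 2 ^ n * \<epsilon>"
      using s nn by (simp only: mult.commute)
    then have "vnorm X1 x1 \<le> \<epsilon>" by simp
    ultimately show "\<exists>x0\<in>vecs X0. \<exists>x1\<in>vecs X1.
        x = x0 + x1 \<and> vnorm X0 x0 \<le> \<epsilon> * 2 ^ n \<and> vnorm X1 x1 \<le> \<epsilon>"
      using x01 by blast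
  qed
qed

section \<open>Compactness\<close>

text \<open>The larger spaces will be sum spaces. Nonnegativity of their norms can be read off the
  infimum, whereas definiteness would rest on the continuous embeddings into the Hausdorff ambient
  space.\<close>

lemma bounded_bilinear_op_mono:
  assumes T: "bounded_bilinear_op X Y T" and "X' \<hookrightarrow> X" "Y' \<hookrightarrow> Y"
    and "normed_space X'" "normed_space Y'"
    and X_pos: "\<And>x. x \<in> vecs X \<Longrightarrow> 0 \<le> vnorm X x" and Y_pos: "\<And>y. y \<in> vecs Y \<Longrightarrow> 0 \<le> vnorm Y y"
  shows "bounded_bilinear_op X' Y' T"
proof -
  obtain A where sX: "vecs X' \<subseteq> vecs X" and A: "\<And>x. x \<in> vecs X' \<Longrightarrow> vnorm X x \<le> A * vnorm X' x"
    using assms unfolding embedded_def by blast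
  obtain B where sY: "vecs Y' \<subseteq> vecs Y" and B: "\<And>y. y \<in> vecs Y' \<Longrightarrow> vnorm Y y \<le> B * vnorm Y' y"
    using assms unfolding embedded_def by blast
  obtain C where C: "\<And>x y. x \<in> vecs X \<Longrightarrow> y \<in> vecs Y \<Longrightarrow> norm (T x y) \<le> C * vnorm X x * vnorm Y y"
    using T unfolding bounded_bilinear_op_def by blast
  \<comment> \<open>Absolute values appear because none of the three constants has a prescribed
    sign.\<close>
  have "norm (T x y) \<le> (\<bar>C\<bar> * \<bar>A\<bar> * \<bar>B\<bar>) * vnorm X' x * vnorm Y' y"
    if "x \<in> vecs X'" "y \<in> vecs Y'" for x y
  proof -
    have nn: "0 \<le> vnorm X' x" "0 \<le> vnorm Y' y" "0 \<le> vnorm X x" "0 \<le> vnorm Y y"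
      using assms that sX sY by (auto simp: normed_space_def)
    have "vnorm X x \<le> \<bar>A\<bar> * vnorm X' x"
      using A[OF that(1)] nn mult_right_mono[OF abs_ge_self, of "vnorm X' x" A] by linarith
    moreover have "vnorm Y y \<le> \<bar>B\<bar> * vnorm Y' y"
      using B[OF that(2)] nn mult_right_mono[OF abs_ge_self, of "vnorm Y' y" B] by linarith
    ultimately have *: "vnorm X x * vnorm Y y \<le> (\<bar>A\<bar> * vnorm X' x) * (\<bar>B\<bar> * vnorm Y' y)"
      using nn by (intro mult_mono) auto
    have "norm (T x y) \<le> C * (vnorm X x * vnorm Y y)"
      using C[of x y] that sX sY by (auto simp: mult.assoc)
    also have "\<dots> \<le> \<bar>C\<bar> * ((\<bar>A\<bar> * vnorm X' x) * (\<bar>B\<bar> * vnorm Y' y))"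
      using * nn by (intro mult_mono[OF abs_ge_self]) simp_all
    finally show ?thesis by (simp add: ac_simps)
  qed
  then show ?thesis
    using T sX sY unfolding bounded_bilinear_op_def by (blast dest: subsetD)
qed

lemma sum_space_norm_nonneg:
  assumes "normed_space X0" "normed_space X1" "x \<in> vecs (sum_space X0 X1)"
  shows "0 \<le> vnorm (sum_space X0 X1) x"
  using assms unfolding sum_space_def nspace.simps
  by (intro cInf_greatest) (auto simp: normed_space_def)

text \<open>A finite \<open>e / 2\<close>-net of a set approximating \<open>S\<close> within
  \<open>e / 2\<close> is an \<open>e\<close>-net of \<open>S\<close>. The approximating set may
  vary with \<open>e\<close>, as the radius of the balls in \<open>E0\<close> and \<open>F0\<close>
  will.\<close>

lemma totally_bounded_approx:
  fixes S :: "'a::metric_space set"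
  assumes "\<And>e. e > 0 \<Longrightarrow> \<exists>S'. totally_bounded S' \<and> (\<forall>s\<in>S. \<exists>s'\<in>S'. dist s' s < e)"
  shows "totally_bounded S"
  unfolding totally_bounded_metric
proof (intro allI impI)
  fix e :: real assume "e > 0"
  then have "e / 2 > 0" by simp
  then obtain S' where S': "totally_bounded S'" "\<forall>s\<in>S. \<exists>s'\<in>S'. dist s' s < e / 2"
    using assms by blast
  then obtain k where "finite k" and k: "S' \<subseteq> (\<Union>x\<in>k. {y. dist x y < e / 2})"
    using \<open>e / 2 > 0\<close> unfolding totally_bounded_metric by blast
  have "S \<subseteq> (\<Union>x\<in>k. {y. dist x y < e})"
  proof
    fix s assume "s \<in> S"
    then obtain s' x where "dist s' s < e / 2" "x \<in> k" "dist x s' < e / 2"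
      using S' k by blast
    then show "s \<in> (\<Union>x\<in>k. {y. dist x y < e})"
      using dist_triangle_half_r[of s' x e s] by (auto simp: dist_commute)
  qed
  with \<open>finite k\<close> show "\<exists>k. finite k \<and> S \<subseteq> (\<Union>x\<in>k. {y. dist x y < e})" by blast
qed

lemma totally_bounded_scaleR:
  fixes S :: "'a::real_normed_vector set"
  assumes "totally_bounded S" "c > 0"
  shows "totally_bounded ((*\<^sub>R) c ` S)"
  unfolding totally_bounded_metric
proof (intro allI impI)
  fix e :: real assume "e > 0"
  then have "e / c > 0" using assms by simp
  then obtain k where k: "finite k" "S \<subseteq> (\<Union>x\<in>k. {y. dist x y < e / c})"
    using assms unfolding totally_bounded_metric by blast
  have "(*\<^sub>R) c ` S \<subseteq> (\<Union>x\<in>(*\<^sub>R) c ` k. {y. dist x y < e})"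
  proof
    fix z assume "z \<in> (*\<^sub>R) c ` S"
    then obtain s x where "z = c *\<^sub>R s" "x \<in> k" "dist x s < e / c"
      using k by blast
    then show "z \<in> (\<Union>x\<in>(*\<^sub>R) c ` k. {y. dist x y < e})"
      using \<open>c > 0\<close> by (auto intro!: bexI[of _ x] simp: dist_norm pos_less_divide_eq mult.commute simp flip: scaleR_diff_right)
  qed
  with k show "\<exists>k. finite k \<and> (*\<^sub>R) c ` S \<subseteq> (\<Union>x\<in>k. {y. dist x y < e})"
    by (meson finite_imageI)
qed

text \<open>Rescaling both arguments to the unit balls pulls out one factor \<open>R\<close> from
  each, and total boundedness survives scaling by \<open>R * R\<close>.\<close>

lemma compact_bilinear_op_totally_bounded_balls:
  assumes T: "compact_bilinear_op X Y T" and X: "normed_space X" and Y: "normed_space Y"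
    and R: "R > 0"
  shows "totally_bounded {T x y | x y. x \<in> vecs X \<and> y \<in> vecs Y \<and> vnorm X x \<le> R \<and> vnorm Y y \<le> R}"
    (is "totally_bounded ?S")
proof -
  let ?U = "{T x y | x y. x \<in> vecs X \<and> y \<in> vecs Y \<and> max (vnorm X x) (vnorm Y y) \<le> 1}"
  have "?S \<subseteq> (*\<^sub>R) (R * R) ` ?U"
  proof
    fix z assume "z \<in> ?S"
    then obtain x y where z: "z = T x y" and xy: "x \<in> vecs X" "y \<in> vecs Y" "vnorm X x \<le> R" "vnorm Y y \<le> R"
      by blast
    define x' where "x' = (1 / R) *\<^sub>R x"
    define y' where "y' = (1 / R) *\<^sub>R y"
    have in': "x' \<in> vecs X" "y' \<in> vecs Y"
      using X Y xy by (auto simp: normed_space_def x'_def y'_def subspace_scale)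
    have "vnorm X x' \<le> 1" "vnorm Y y' \<le> 1"
      using X Y xy R by (simp_all add: normed_space_def x'_def y'_def)
    then have "T x' y' \<in> ?U" using in' by auto
    moreover have "z = (R * R) *\<^sub>R T x' y'"
    proof -
      have "x = R *\<^sub>R x'" "y = R *\<^sub>R y'" using R by (auto simp: x'_def y'_def)
      then have "z = T (R *\<^sub>R x') (R *\<^sub>R y')" by (simp add: z)
      also have "\<dots> = R *\<^sub>R T x' (R *\<^sub>R y')"
        using T in' xy \<open>y = R *\<^sub>R y'\<close> unfolding compact_bilinear_op_def bounded_bilinear_op_def by metis
      also have "T x' (R *\<^sub>R y') = R *\<^sub>R T x' y'"
        using T in' unfolding compact_bilinear_op_def bounded_bilinear_op_def by metis
      finally show ?thesis by simp
    qed
    ultimately show "z \<in> (*\<^sub>R) (R * R) ` ?U" by blast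
  qed
  moreover have "totally_bounded ((*\<^sub>R) (R * R) ` ?U)"
    using T R unfolding compact_bilinear_op_def by (intro totally_bounded_scaleR) auto
  ultimately show ?thesis by (rule totally_bounded_subset[rotated])
qed

text \<open>This separates the compactness argument from the function parameters, which enter only
  through the existence of the splittings.\<close>

lemma compact_bilinear_op_of_splittings:
  assumes nE: "normed_space E0" "normed_space E1" and nF: "normed_space F0" "normed_space F1"
    and E: "intermediate_space E0 E1 E" and F: "intermediate_space F0 F1 F"
    and splitE: "\<And>\<epsilon>. \<epsilon> > 0 \<Longrightarrow> \<exists>R. \<forall>x\<in>vecs E. vnorm E x \<le> 1 \<longrightarrow>
      (\<exists>x0\<in>vecs E0. \<exists>x1\<in>vecs E1. x = x0 + x1 \<and> vnorm E0 x0 \<le> R \<and> vnorm E1 x1 \<le> \<epsilon>)"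
    and splitF: "\<And>\<epsilon>. \<epsilon> > 0 \<Longrightarrow> \<exists>R. \<forall>y\<in>vecs F. vnorm F y \<le> 1 \<longrightarrow>
      (\<exists>y0\<in>vecs F0. \<exists>y1\<in>vecs F1. y = y0 + y1 \<and> vnorm F0 y0 \<le> R \<and> vnorm F1 y1 \<le> \<epsilon>)"
    and T: "bounded_bilinear_op (sum_space E0 E1) (sum_space F0 F1) T"
    and cT: "compact_bilinear_op E0 F0 T"
  shows "compact_bilinear_op E F T"
  unfolding compact_bilinear_op_def
proof
  show "bounded_bilinear_op E F T"
    using E F nE nF T
    by (intro bounded_bilinear_op_mono[OF T])
       (auto simp: intermediate_space_def banach_space_def intro: sum_space_norm_nonneg)
next
  let ?SE = "sum_space E0 E1" and ?SF = "sum_space F0 F1"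
  obtain C where C: "\<And>x y. x \<in> vecs ?SE \<Longrightarrow> y \<in> vecs ?SF \<Longrightarrow>
      norm (T x y) \<le> C * vnorm ?SE x * vnorm ?SF y"
    using T unfolding bounded_bilinear_op_def by blast
  obtain A where sE: "vecs E \<subseteq> vecs ?SE"
    and A: "\<And>x. x \<in> vecs E \<Longrightarrow> vnorm ?SE x \<le> A * vnorm E x"
    using E unfolding intermediate_space_def embedded_def by blast
  obtain B where sF: "vecs F \<subseteq> vecs ?SF"
    and B: "\<And>y. y \<in> vecs F \<Longrightarrow> vnorm ?SF y \<le> B * vnorm F y"
    using F unfolding intermediate_space_def embedded_def by blast
  have addl: "T (x + x') y = T x y + T x' y"
    if "x \<in> vecs ?SE" "x' \<in> vecs ?SE" "y \<in> vecs ?SF" for x x' y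
    using T that unfolding bounded_bilinear_op_def by blast
  have addr: "T x (y + y') = T x y + T x y'"
    if "x \<in> vecs ?SE" "y \<in> vecs ?SF" "y' \<in> vecs ?SF" for x y y'
    using T that unfolding bounded_bilinear_op_def by blast
  let ?S = "{T x y | x y. x \<in> vecs E \<and> y \<in> vecs F \<and> max (vnorm E x) (vnorm F y) \<le> 1}"
  show "totally_bounded ?S"
  proof (rule totally_bounded_approx)
    fix e :: real assume "e > 0"
    \<comment> \<open>The errors \<open>T x y1\<close>, \<open>T x1 y\<close> and
      \<open>T x1 y1\<close> will add up to at most \<open>(Q - 1) * \<epsilon>\<close>. The final
      summand 1 makes \<open>Q\<close> positive and the last estimate strict.\<close>
    define Q where "Q = \<bar>C\<bar> * (\<bar>A\<bar> + \<bar>B\<bar> + 1) + 1"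
    have "Q > 0" by (simp add: Q_def add_nonneg_pos)
    \<comment> \<open>The cap at 1 lets the quadratic error \<open>T x1 y1\<close> be bounded
      linearly in \<epsilon>.\<close>
    define \<epsilon> where "\<epsilon> = min 1 (e / Q)"
    have eps: "\<epsilon> > 0" "\<epsilon> \<le> 1" "Q * \<epsilon> \<le> e"
      using \<open>Q > 0\<close> \<open>e > 0\<close> by (auto simp: \<epsilon>_def min_def field_simps)
    obtain R1 where R1: "\<And>x. x \<in> vecs E \<Longrightarrow> vnorm E x \<le> 1 \<Longrightarrow>
      (\<exists>x0\<in>vecs E0. \<exists>x1\<in>vecs E1. x = x0 + x1 \<and> vnorm E0 x0 \<le> R1 \<and> vnorm E1 x1 \<le> \<epsilon>)"
      using splitE[OF eps(1)] by blast
    obtain R2 where R2: "\<And>y. y \<in> vecs F \<Longrightarrow> vnorm F y \<le> 1 \<Longrightarrow>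
      (\<exists>y0\<in>vecs F0. \<exists>y1\<in>vecs F1. y = y0 + y1 \<and> vnorm F0 y0 \<le> R2 \<and> vnorm F1 y1 \<le> \<epsilon>)"
      using splitF[OF eps(1)] by blast
    \<comment> \<open>A common radius for both factors, kept positive for the rescaling.\<close>
    define R where "R = max 1 (max R1 R2)"
    let ?S' = "{T x y | x y. x \<in> vecs E0 \<and> y \<in> vecs F0 \<and> vnorm E0 x \<le> R \<and> vnorm F0 y \<le> R}"
    have "totally_bounded ?S'"
      using cT nE nF by (intro compact_bilinear_op_totally_bounded_balls) (auto simp: R_def)
    moreover have "\<exists>s'\<in>?S'. dist s' s < e" if sS: "s \<in> ?S" for s
    proof -
      obtain x y where s: "s = T x y" and xy: "x \<in> vecs E" "y \<in> vecs F" "vnorm E x \<le> 1" "vnorm F y \<le> 1"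
        using sS by auto
      obtain x0 x1 where x: "x0 \<in> vecs E0" "x1 \<in> vecs E1" "x = x0 + x1" "vnorm E0 x0 \<le> R1" "vnorm E1 x1 \<le> \<epsilon>"
        using R1[of x] xy by blast
      obtain y0 y1 where y: "y0 \<in> vecs F0" "y1 \<in> vecs F1" "y = y0 + y1" "vnorm F0 y0 \<le> R2" "vnorm F1 y1 \<le> \<epsilon>"
        using R2[of y] xy by blast
      have mem: "x \<in> vecs ?SE" "x0 \<in> vecs ?SE" "x1 \<in> vecs ?SE"
        "y \<in> vecs ?SF" "y0 \<in> vecs ?SF" "y1 \<in> vecs ?SF"
        using xy x y sE sF nE nF by (auto intro: sum_space_left sum_space_right)
      have nn: "0 \<le> vnorm ?SE x" "0 \<le> vnorm ?SE x1" "0 \<le> vnorm ?SF y" "0 \<le> vnorm ?SF y1"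
        using mem nE nF by (auto intro: sum_space_norm_nonneg)
      have b1: "vnorm ?SE x1 \<le> \<epsilon>" "vnorm ?SF y1 \<le> \<epsilon>"
        using sum_space_right(2)[OF nE x(2)] sum_space_right(2)[OF nF y(2)] x y by auto
      have nn': "0 \<le> vnorm E x" "0 \<le> vnorm F y"
        using E F xy by (auto simp: intermediate_space_def banach_space_def normed_space_def)
      have "A * vnorm E x \<le> \<bar>A\<bar> * 1" "B * vnorm F y \<le> \<bar>B\<bar> * 1"
        using nn' xy by (intro mult_mono[OF abs_ge_self]; simp)+
      then have b2: "vnorm ?SE x \<le> \<bar>A\<bar>" "vnorm ?SF y \<le> \<bar>B\<bar>"
        using A[OF xy(1)] B[OF xy(2)] by auto
      have bound: "norm (T u v) \<le> \<bar>C\<bar> * (p * q)"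
        if "u \<in> vecs ?SE" "v \<in> vecs ?SF" "vnorm ?SE u \<le> p" "vnorm ?SF v \<le> q" for u v p q
      proof -
        have nn: "0 \<le> vnorm ?SE u" "0 \<le> vnorm ?SF v"
          using that nE nF by (auto intro: sum_space_norm_nonneg)
        have "norm (T u v) \<le> C * (vnorm ?SE u * vnorm ?SF v)"
          using C[of u v] that by (simp add: mult.assoc)
        also have "\<dots> \<le> \<bar>C\<bar> * (p * q)"
          using that nn by (intro mult_mono) auto
        finally show ?thesis .
      qed
      have 1: "norm (T x y1) \<le> \<bar>C\<bar> * (\<bar>A\<bar> * \<epsilon>)"
        using mem b1 b2 by (intro bound) auto
      have 2: "norm (T x1 y) \<le> \<bar>C\<bar> * (\<epsilon> * \<bar>B\<bar>)"
        using mem b1 b2 by (intro bound) auto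
      have 3: "norm (T x1 y1) \<le> \<bar>C\<bar> * (\<epsilon> * 1)"
        using mem b1 eps by (intro bound) auto
      have "T x y = T x y0 + T x y1"
        using addr mem y by simp
      moreover have "T x1 y = T x1 y0 + T x1 y1"
        using addr mem y by simp
      moreover have "T x y0 = T x0 y0 + T x1 y0"
        using addl mem x by simp
      \<comment> \<open>Replacing \<open>y0\<close> by \<open>y - y1\<close> in
        \<open>T x1 y0\<close> leaves only terms whose arguments have controlled sum norms:
        \<open>y\<close> by the embedding of \<open>F\<close>, \<open>y1\<close> by the
        splitting.\<close>
      ultimately have "T x0 y0 - T x y = - T x y1 - T x1 y + T x1 y1"
        by (simp add: algebra_simps)
      then have "dist (T x0 y0) s \<le> norm (T x y1) + norm (T x1 y) + norm (T x1 y1)"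
        unfolding s dist_norm
        by (smt (verit, best) norm_minus_cancel norm_triangle_ineq norm_triangle_ineq4)
      also have "\<dots> \<le> (Q - 1) * \<epsilon>"
        using 1 2 3 by (simp add: Q_def algebra_simps)
      also have "\<dots> < e" using eps by (simp add: algebra_simps)
      finally have "dist (T x0 y0) s < e" .
      moreover have "vnorm E0 x0 \<le> R" "vnorm F0 y0 \<le> R"
        using x y by (auto simp: R_def)
      then have "T x0 y0 \<in> ?S'" using x y by blast
      ultimately show ?thesis by blast
    qed
    ultimately show "\<exists>S'. totally_bounded S' \<and> (\<forall>s\<in>?S. \<exists>s'\<in>S'. dist s' s < e)"
      by (intro exI[of _ ?S'] conjI ballI)
  qed
qed

theorem theorem4p3:
  fixes E0 E1 E :: "'a::hausdorff_tvs nspace"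
    and F0 F1 F :: "'b::hausdorff_tvs nspace"
    and T :: "'a \<Rightarrow> 'b \<Rightarrow> 'g::banach"
    and \<rho> \<gamma> :: "real \<Rightarrow> real"
  assumes "banach_couple E0 E1"
    and "banach_couple F0 F1"
    and "class_B_pm \<rho>"
    and "\<And>t. t > 0 \<Longrightarrow> \<gamma> t = 1 / dilation \<rho> (1 / t)"
    and "class_K \<gamma> E0 E1 E"
    and "class_K \<rho> F0 F1 F"
    and "bounded_bilinear_op (sum_space E0 E1) (sum_space F0 F1) T"
    and "compact_bilinear_op E0 F0 T"
  shows "compact_bilinear_op E F T"
proof (rule compact_bilinear_op_of_splittings)
  have B: "class_B \<rho>" using assms(3) by (simp add: class_B_pm_def)
  show nE: "normed_space E0" "normed_space E1" and nF: "normed_space F0" "normed_space F1"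
    using assms(1,2) by (auto simp: banach_couple_def banach_space_def)
  show "intermediate_space E0 E1 E" "intermediate_space F0 F1 F"
    using assms(5,6) by (auto simp: class_K_def)
  have \<rho>_pos: "\<rho> (2 ^ n) > 0" for n :: nat
    using B by (simp add: class_B_def function_parameter_def)
  have \<rho>_small: "\<exists>n::nat. \<rho> (2 ^ n) < \<epsilon> * 2 ^ n" if \<epsilon>: "\<epsilon> > 0" for \<epsilon>
    using class_B_pm_dilation_small[OF assms(3) \<epsilon>] le_dilation[OF B]
    by (metis order_le_less_trans zero_less_numeral zero_less_power)
  have \<gamma>_pos: "\<gamma> (2 ^ n) > 0" for n :: nat
    using assms(4) dilation_pos[OF B] by simp
  \<comment> \<open>With this bound a single smallness estimate for the dilation function serves
    both \<rho> and \<gamma>.\<close>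
  have \<gamma>_le: "\<gamma> (2 ^ n) \<le> dilation \<rho> (2 ^ n)" for n :: nat
    using one_le_dilation_mult_inverse[OF B, of "2 ^ n"] dilation_pos[OF B, of "1 / 2 ^ n"]
    by (simp add: assms(4) divide_le_eq)
  have \<gamma>_small: "\<exists>n::nat. \<gamma> (2 ^ n) < \<epsilon> * 2 ^ n" if \<epsilon>: "\<epsilon> > 0" for \<epsilon>
    using class_B_pm_dilation_small[OF assms(3) \<epsilon>] \<gamma>_le by (metis order_le_less_trans)
  fix \<epsilon> :: real assume "\<epsilon> > 0"
  show "\<exists>R. \<forall>x\<in>vecs E. vnorm E x \<le> 1 \<longrightarrow>
      (\<exists>x0\<in>vecs E0. \<exists>x1\<in>vecs E1. x = x0 + x1 \<and> vnorm E0 x0 \<le> R \<and> vnorm E1 x1 \<le> \<epsilon>)"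
    using class_K_split[OF nE assms(5) \<gamma>_pos \<gamma>_small \<open>\<epsilon> > 0\<close>] by metis
  show "\<exists>R. \<forall>y\<in>vecs F. vnorm F y \<le> 1 \<longrightarrow>
      (\<exists>y0\<in>vecs F0. \<exists>y1\<in>vecs F1. y = y0 + y1 \<and> vnorm F0 y0 \<le> R \<and> vnorm F1 y1 \<le> \<epsilon>)"
    using class_K_split[OF nF assms(6) \<rho>_pos \<rho>_small \<open>\<epsilon> > 0\<close>] by metis
qed (use assms in auto)

end
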